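(* Let $q\geq4$ be an integer, $n=q^2-1$, and let $A_0=I,A_1,A_2,A_3$ be the adjacency matrices of a symmetric 3-class association scheme on $n$ points with first eigenmatrix \[ P=\begin{bmatrix}1&\frac{q^2}{2}-q&\frac{q^2}{2}&q-2\\ 1&\frac q2&-\frac q2&-1\\ 1&-\frac q2+1&-\frac q2&q-2\\ 1&-\frac q2&\frac q2&-1\end{bmatrix}. \] Let $w_1,w_2,w_3$ be nonzero complex numbers. Then $W=A_0+w_1A_1+w_2A_2+w_3A_3$ is a type-II matrix if and only if one of the following holds: (i) $w_1=w_2=w_3$ and $w_3+\frac1{w_3}+q^2-3=0$; (ii) $w_3+\frac1{w_3}+q^2-3=0$ and $w_1=w_2=\frac{-(q-3)w_3+(q-1)}{q^2-2q-1}$; (iii) $w_1+\frac1{w_1}=\frac{2(q^2-6)}{q^2-4}$, $w_2=-1$, $w_3=w_1$; (iv) $w_1=w_3=1$ and $w_2+\frac1{w_2}=\frac{-2(q^2-2)}{q^2}$; (v) $w_1+\frac1{w_1}=-\frac2q$, $w_2=\frac1{w_1}$, $w_3=1$; (vi) for some real number $r$ with $r^2=(17q-1)(q-1)$, setting \[ a_{0,1}=\frac{-(q-1)(q-2)+(q+2)r}{2q(q+1)},\quad a_{0,2}=\frac{(q+2)(q-1)-(q-2)r}{2q(q-3)},\quad a_{0,3}=\frac{5q^2-2q-19-(q-1)r}{2(q+1)(q-3)}, \] \[ a_{1,2}=\frac{2(-q^4+2q^3+4q^2-10q+1+(q-1)r)}{q^2(q+1)(q-3)},\quad a_{1,3}=-a_{0,2},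 \] one has $w_1+\frac1{w_1}=a_{0,1}$ and $w_i=\frac{w_1^2-1}{a_{1,i}w_1-a_{0,i}}$ for $i=2,3$. Moreover, in case (vi), $w_1w_2=-w_3$ holds.
   Context: A symmetric association scheme with adjacency matrices $A_0=I,A_1,\dots,A_d$: the $A_i$ are symmetric $n\times n$ $(0,1)$-matrices summing to the all-ones matrix $J$, whose span (the Bose--Mesner algebra) is closed under multiplication; it has primitive idempotents $E_0=\frac1nJ,E_1,\dots,E_d$, and the first eigenmatrix $P=(P_{i,j})$ is defined by $A_j=\sum_iP_{i,j}E_i$. A type-II matrix is an $n\times n$ matrix $W$ with nonzero complex entries such that $W(W^{(-)})^\top=nI$, where $W^{(-)}$ is the entrywise inverse of $W$. *)

theory Defs
  imports "Jordan_Normal_Form.Matrix"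
begin

definition lin_comb :: "nat \<Rightarrow> nat \<Rightarrow> (nat \<Rightarrow> complex) \<Rightarrow> (nat \<Rightarrow> complex mat) \<Rightarrow> complex mat" where
  "lin_comb n d c M = mat n n (\<lambda>(a,b). \<Sum>k\<le>d. c k * M k $$ (a,b))"

definition all_ones :: "nat \<Rightarrow> complex mat" where
  "all_ones n = mat n n (\<lambda>_. 1)"

definition sym_assoc_scheme :: "nat \<Rightarrow> nat \<Rightarrow> (nat \<Rightarrow> complex mat) \<Rightarrow> bool" where
  "sym_assoc_scheme n d A \<longleftrightarrow>
     n \<ge> 1 \<and>
     (\<forall>i\<le>d. A i \<in> carrier_mat n n) \<and>
     A 0 = 1\<^sub>m n \<and>
     (\<forall>i\<le>d. \<forall>a<n. \<forall>b<n. A i $$ (a,b) = 0 \<or> A i $$ (a,b) = 1) \<and>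
     (\<forall>i\<le>d. A i \<noteq> 0\<^sub>m n n) \<and>
     (\<forall>i\<le>d. transpose_mat (A i) = A i) \<and>
     lin_comb n d (\<lambda>_. 1) A = all_ones n \<and>
     (\<forall>i\<le>d. \<forall>j\<le>d. \<exists>p. A i * A j = lin_comb n d p A)"

text \<open>P is the first eigenmatrix of the scheme: there are primitive idempotents
  E 0 = J/n, E 1, ..., E d of the Bose--Mesner algebra with A j = sum_i P i j E i.
  Primitive idempotents: d+1 nonzero, pairwise orthogonal idempotents of the
  (d+1)-dimensional Bose--Mesner algebra summing to I.\<close>
definition first_eigenmatrix :: "nat \<Rightarrow> nat \<Rightarrow> (nat \<Rightarrow> complex mat) \<Rightarrow> (nat \<Rightarrow> nat \<Rightarrow> complex) \<Rightarrow> bool" where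
  "first_eigenmatrix n d A P \<longleftrightarrow>
     (\<exists>E :: nat \<Rightarrow> complex mat.
        (\<forall>i\<le>d. E i \<in> carrier_mat n n) \<and>
        E 0 = (1 / of_nat n) \<cdot>\<^sub>m all_ones n \<and>
        (\<forall>i\<le>d. E i \<noteq> 0\<^sub>m n n) \<and>
        (\<forall>i\<le>d. \<exists>c. E i = lin_comb n d c A) \<and>
        (\<forall>i\<le>d. \<forall>j\<le>d. E i * E j = (if i = j then E i else 0\<^sub>m n n)) \<and>
        lin_comb n d (\<lambda>_. 1) E = 1\<^sub>m n \<and>
        (\<forall>j\<le>d. A j = lin_comb n d (\<lambda>i. P i j) E))"

definition entry_inv :: "complex mat \<Rightarrow> complex mat" where
  "entry_inv W = mat (dim_row W) (dim_col W) (\<lambda>ij. inverse (W $$ ij))"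

definition type_II :: "nat \<Rightarrow> complex mat \<Rightarrow> bool" where
  "type_II n W \<longleftrightarrow> W \<in> carrier_mat n n \<and>
     (\<forall>a<n. \<forall>b<n. W $$ (a,b) \<noteq> 0) \<and>
     W * transpose_mat (entry_inv W) = of_nat n \<cdot>\<^sub>m 1\<^sub>m n"

definition P_thm :: "nat \<Rightarrow> nat \<Rightarrow> nat \<Rightarrow> complex" where
  "P_thm q i j = (let x = (of_nat q :: complex) in
     [[1, x^2/2 - x, x^2/2, x - 2],
      [1, x/2, - x/2, -1],
      [1, - x/2 + 1, - x/2, x - 2],
      [1, - x/2, x/2, -1]] ! i ! j)"

end

theory Submission
  imports Defs
begin

text \<open>In the basis of primitive idempotents, \<open>W\<close> is type-II iff
  \<open>(\<Sum>\<^sub>j P\<^sub>i\<^sub>j w\<^sub>j) (\<Sum>\<^sub>j P\<^sub>i\<^sub>j / w\<^sub>j) = n\<close> for every \<open>i\<close>. Rows 1 and 3 of \<open>P\<close> differ only in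
  the sign of two entries, and subtracting their equations gives
  \<open>(w\<^sub>1 - w\<^sub>2) (w\<^sub>3 - 1) (w\<^sub>1 w\<^sub>2 + w\<^sub>3) = 0\<close>. The component \<open>w\<^sub>1 = w\<^sub>2\<close> yields (i) and (ii),
  the component \<open>w\<^sub>3 = 1\<close> yields (iv) and (v). On \<open>w\<^sub>3 = - w\<^sub>1 w\<^sub>2\<close> the row 2 equation splits
  into \<open>w\<^sub>2 = - 1\<close>, which gives (iii), and an equation linear in \<open>w\<^sub>2\<close>; eliminating \<open>w\<^sub>2\<close>
  with the latter leaves a palindromic quartic in \<open>w\<^sub>1\<close>, that is a quadratic in
  \<open>w\<^sub>1 + 1 / w\<^sub>1\<close>, whose discriminant is \<open>(x + 2)\<^sup>2 (17x - 1) (x - 1)\<close> at \<open>x = q\<close>; its roots are the values \<open>a\<^sub>0\<^sub>,\<^sub>1\<close> of (vi).\<close>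

subsection \<open>Type-II matrices in a Bose--Mesner algebra\<close>

lemma lin_comb_carrier [simp]: "lin_comb n d c M \<in> carrier_mat n n"
  by (simp add: lin_comb_def)

lemma dim_lin_comb [simp]: "dim_row (lin_comb n d c M) = n" "dim_col (lin_comb n d c M) = n"
  by (simp_all add: lin_comb_def)

lemma index_lin_comb [simp]:
  "a < n \<Longrightarrow> b < n \<Longrightarrow> lin_comb n d c M $$ (a, b) = (\<Sum>k\<le>d. c k * M k $$ (a, b))"
  by (simp add: lin_comb_def)

lemma lin_comb_cong:
  assumes "\<And>k. k \<le> d \<Longrightarrow> c k = c' k" and "\<And>k. k \<le> d \<Longrightarrow> M k = M' k"
  shows "lin_comb n d c M = lin_comb n d c' M'"
  using assms by (intro eq_matI) (auto intro!: sum.cong)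

lemma lin_comb_smult:
  assumes "\<And>k. k \<le> d \<Longrightarrow> M k \<in> carrier_mat n n"
  shows "lin_comb n d c (\<lambda>k. a k \<cdot>\<^sub>m M k) = lin_comb n d (\<lambda>k. c k * a k) M"
  by (rule eq_matI) (auto simp: mult.assoc carrier_matD[OF assms] intro!: sum.cong)

lemma smult_lin_comb: "x \<cdot>\<^sub>m lin_comb n d c M = lin_comb n d (\<lambda>k. x * c k) M"
  by (rule eq_matI) (auto simp: sum_distrib_left mult.assoc)

lemma lin_comb_single:
  assumes "j \<le> d" "B \<in> carrier_mat n n"
  shows "lin_comb n d c (\<lambda>k. if k = j then B else 0\<^sub>m n n) = c j \<cdot>\<^sub>m B"
proof (rule eq_matI)
  fix a b assume "a < dim_row (c j \<cdot>\<^sub>m B)" "b < dim_col (c j \<cdot>\<^sub>m B)"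
  then have "a < n" "b < n" using assms(2) by auto
  moreover have "c k * (if k = j then B else 0\<^sub>m n n) $$ (a, b)
      = (if k = j then c j * B $$ (a, b) else 0)" for k
    using \<open>a < n\<close> \<open>b < n\<close> by simp
  ultimately show "lin_comb n d c (\<lambda>k. if k = j then B else 0\<^sub>m n n) $$ (a, b) = (c j \<cdot>\<^sub>m B) $$ (a, b)"
    using assms by simp
qed (use assms in auto)

lemma transpose_lin_comb:
  assumes "\<And>k. k \<le> d \<Longrightarrow> M k \<in> carrier_mat n n"
  shows "transpose_mat (lin_comb n d c M) = lin_comb n d c (\<lambda>k. transpose_mat (M k))"
  by (rule eq_matI) (auto simp: carrier_matD[OF assms] intro!: sum.cong)

lemma lin_comb_mult_left:
  assumes M: "\<And>k. k \<le> d \<Longrightarrow> M k \<in> carrier_mat n n" and B: "B \<in> carrier_mat n n"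
  shows "lin_comb n d c M * B = lin_comb n d c (\<lambda>k. M k * B)"
proof (rule eq_matI)
  fix a b assume "a < dim_row (lin_comb n d c (\<lambda>k. M k * B))" "b < dim_col (lin_comb n d c (\<lambda>k. M k * B))"
  then have ab: "a < n" "b < n" by auto
  have MB: "(M k * B) $$ (a, b) = (\<Sum>i<n. M k $$ (a, i) * B $$ (i, b))" if "k \<le> d" for k
    using ab M[OF that] B by (auto simp: scalar_prod_def lessThan_atLeast0)
  have "(lin_comb n d c M * B) $$ (a, b) = (\<Sum>i<n. (\<Sum>k\<le>d. c k * M k $$ (a, i)) * B $$ (i, b))"
    using ab B by (auto simp: scalar_prod_def lessThan_atLeast0 intro!: sum.cong)
  also have "\<dots> = (\<Sum>k\<le>d. c k * (\<Sum>i<n. M k $$ (a, i) * B $$ (i, b)))"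
    unfolding sum_distrib_right sum_distrib_left by (subst sum.swap) (simp add: mult.assoc)
  also have "\<dots> = lin_comb n d c (\<lambda>k. M k * B) $$ (a, b)"
    using ab by (simp add: MB)
  finally show "(lin_comb n d c M * B) $$ (a, b) = lin_comb n d c (\<lambda>k. M k * B) $$ (a, b)" .
qed (use B in auto)

lemma lin_comb_mult_right:
  assumes M: "\<And>k. k \<le> d \<Longrightarrow> M k \<in> carrier_mat n n" and B: "B \<in> carrier_mat n n"
  shows "B * lin_comb n d c M = lin_comb n d c (\<lambda>k. B * M k)"
proof -
  have "transpose_mat (B * lin_comb n d c M)
      = lin_comb n d c (\<lambda>k. transpose_mat (M k)) * transpose_mat B"
    using transpose_mult[OF B lin_comb_carrier] transpose_lin_comb[OF M] by simp
  also have "\<dots> = lin_comb n d c (\<lambda>k. transpose_mat (M k) * transpose_mat B)"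
    by (rule lin_comb_mult_left) (use M B in auto)
  also have "\<dots> = lin_comb n d c (\<lambda>k. transpose_mat (B * M k))"
    by (rule lin_comb_cong) (use transpose_mult[OF B M] in auto)
  also have "\<dots> = transpose_mat (lin_comb n d c (\<lambda>k. B * M k))"
    by (rule transpose_lin_comb[symmetric]) (use M B in auto)
  finally show ?thesis by simp
qed

lemma lin_comb_lin_comb:
  assumes "\<And>j. j \<le> d \<Longrightarrow> A j = lin_comb n d (\<lambda>i. P i j) E"
  shows "lin_comb n d c A = lin_comb n d (\<lambda>i. \<Sum>j\<le>d. c j * P i j) E"
proof (rule eq_matI)
  fix a b assume "a < dim_row (lin_comb n d (\<lambda>i. \<Sum>j\<le>d. c j * P i j) E)"
    "b < dim_col (lin_comb n d (\<lambda>i. \<Sum>j\<le>d. c j * P i j) E)"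
  then have ab: "a < n" "b < n" by auto
  have "lin_comb n d c A $$ (a, b) = (\<Sum>j\<le>d. c j * (\<Sum>i\<le>d. P i j * E i $$ (a, b)))"
    using ab assms by simp
  also have "\<dots> = (\<Sum>i\<le>d. (\<Sum>j\<le>d. c j * P i j) * E i $$ (a, b))"
    unfolding sum_distrib_right sum_distrib_left by (subst sum.swap) (simp add: mult.assoc)
  finally show "lin_comb n d c A $$ (a, b) = lin_comb n d (\<lambda>i. \<Sum>j\<le>d. c j * P i j) E $$ (a, b)"
    using ab by simp
qed auto

locale nonzero_orthogonal_idempotents =
  fixes n d :: nat and E :: "nat \<Rightarrow> complex mat"
  assumes carrier: "i \<le> d \<Longrightarrow> E i \<in> carrier_mat n n"
    and nonzero: "i \<le> d \<Longrightarrow> E i \<noteq> 0\<^sub>m n n"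
    and orthogonal: "i \<le> d \<Longrightarrow> j \<le> d \<Longrightarrow> E i * E j = (if i = j then E i else 0\<^sub>m n n)"
begin

lemma lin_comb_mult_idempotent:
  assumes j: "j \<le> d"
  shows "lin_comb n d c E * E j = c j \<cdot>\<^sub>m E j"
proof -
  have "lin_comb n d c E * E j = lin_comb n d c (\<lambda>k. E k * E j)"
    by (rule lin_comb_mult_left) (use carrier j in auto)
  also have "\<dots> = lin_comb n d c (\<lambda>k. if k = j then E j else 0\<^sub>m n n)"
    by (rule lin_comb_cong) (use orthogonal j in auto)
  also have "\<dots> = c j \<cdot>\<^sub>m E j"
    using j carrier by (rule lin_comb_single) (use j in auto)
  finally show ?thesis .
qed

lemma lin_comb_eq_iff: "lin_comb n d c E = lin_comb n d c' E \<longleftrightarrow> (\<forall>i\<le>d. c i = c' i)"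
proof (intro iffI allI impI)
  fix i assume eq: "lin_comb n d c E = lin_comb n d c' E" and i: "i \<le> d"
  obtain a b where ab: "a < n" "b < n" "E i $$ (a, b) \<noteq> 0"
    using nonzero[OF i] carrier[OF i] by (metis carrier_matD eq_matI index_zero_mat)
  have "c i \<cdot>\<^sub>m E i = c' i \<cdot>\<^sub>m E i"
    using lin_comb_mult_idempotent[OF i, of c] lin_comb_mult_idempotent[OF i, of c'] eq by simp
  then have "(c i \<cdot>\<^sub>m E i) $$ (a, b) = (c' i \<cdot>\<^sub>m E i) $$ (a, b)" by simp
  then show "c i = c' i" using ab carrier[OF i] by simp
qed (simp cong: lin_comb_cong)

lemma lin_comb_mult_lin_comb:
  "lin_comb n d c E * lin_comb n d c' E = lin_comb n d (\<lambda>i. c i * c' i) E"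
proof -
  have "lin_comb n d c E * lin_comb n d c' E = lin_comb n d c' (\<lambda>j. lin_comb n d c E * E j)"
    by (rule lin_comb_mult_right) (use carrier in auto)
  also have "\<dots> = lin_comb n d c' (\<lambda>j. c j \<cdot>\<^sub>m E j)"
    by (rule lin_comb_cong) (simp_all add: lin_comb_mult_idempotent)
  also have "\<dots> = lin_comb n d (\<lambda>i. c i * c' i) E"
    using lin_comb_smult[OF carrier] by (simp add: mult.commute)
  finally show ?thesis .
qed

end

lemma zero_one_sum_eq_oneE:
  fixes f :: "'i \<Rightarrow> 'a :: semiring_char_0"
  assumes "finite I" and zero_one: "\<And>i. i \<in> I \<Longrightarrow> f i = 0 \<or> f i = 1" and "sum f I = 1"
  obtains k where "k \<in> I" "\<And>i. i \<in> I \<Longrightarrow> f i = (if i = k then 1 else 0)"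
proof -
  have "sum f I = (\<Sum>i\<in>I. of_bool (f i = 1))"
    using zero_one by (intro sum.cong) auto
  then have "card {i \<in> I. f i = 1} = 1"
    using assms by (simp add: Int_def)
  then obtain k where "{i \<in> I. f i = 1} = {k}" by (auto simp: card_1_singleton_iff)
  then have "k \<in> I" "\<And>i. i \<in> I \<Longrightarrow> f i = (if i = k then 1 else 0)" using zero_one by auto
  then show ?thesis by (rule that)
qed

lemma sym_assoc_scheme_entryE:
  assumes scheme: "sym_assoc_scheme n d A" and ab: "a < n" "b < n"
  obtains k where "k \<le> d" "\<And>c. lin_comb n d c A $$ (a, b) = c k"
proof -
  have "lin_comb n d (\<lambda>_. 1) A $$ (a, b) = all_ones n $$ (a, b)"
    using scheme unfolding sym_assoc_scheme_def by simp
  then have "(\<Sum>i\<le>d. A i $$ (a, b)) = 1" using ab by (simp add: all_ones_def)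
  moreover have "A i $$ (a, b) = 0 \<or> A i $$ (a, b) = 1" if "i \<le> d" for i
    using scheme that ab unfolding sym_assoc_scheme_def by blast
  ultimately obtain k where k: "k \<le> d" "\<And>i. i \<le> d \<Longrightarrow> A i $$ (a, b) = (if i = k then 1 else 0)"
    using zero_one_sum_eq_oneE[of "{..d}" "\<lambda>i. A i $$ (a, b)"] by auto
  have "lin_comb n d c A $$ (a, b) = c k" for c
  proof -
    have "(\<Sum>i\<le>d. c i * A i $$ (a, b)) = (\<Sum>i\<le>d. if i = k then c k else 0)"
      using k by (intro sum.cong) auto
    then show ?thesis using ab k(1) by simp
  qed
  with k(1) show ?thesis by (rule that)
qed

lemma entry_inv_lin_comb:
  assumes "sym_assoc_scheme n d A"
  shows "entry_inv (lin_comb n d w A) = lin_comb n d (\<lambda>i. inverse (w i)) A"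
proof (rule eq_matI)
  fix a b assume "a < dim_row (lin_comb n d (\<lambda>i. inverse (w i)) A)"
    "b < dim_col (lin_comb n d (\<lambda>i. inverse (w i)) A)"
  then have ab: "a < n" "b < n" by auto
  obtain k where "\<And>c. lin_comb n d c A $$ (a, b) = c k"
    using sym_assoc_scheme_entryE[OF assms ab] by metis
  then show "entry_inv (lin_comb n d w A) $$ (a, b) = lin_comb n d (\<lambda>i. inverse (w i)) A $$ (a, b)"
    using ab by (simp add: entry_inv_def del: index_lin_comb)
qed (simp_all add: entry_inv_def)

lemma transpose_lin_comb_scheme:
  assumes "sym_assoc_scheme n d A"
  shows "transpose_mat (lin_comb n d c A) = lin_comb n d c A"
proof -
  have "transpose_mat (lin_comb n d c A) = lin_comb n d c (\<lambda>k. transpose_mat (A k))"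
    by (rule transpose_lin_comb) (use assms in \<open>simp add: sym_assoc_scheme_def\<close>)
  also have "\<dots> = lin_comb n d c A"
    by (rule lin_comb_cong) (use assms in \<open>simp_all add: sym_assoc_scheme_def\<close>)
  finally show ?thesis .
qed

definition scheme_eigenvalue :: "nat \<Rightarrow> (nat \<Rightarrow> nat \<Rightarrow> complex) \<Rightarrow> (nat \<Rightarrow> complex) \<Rightarrow> nat \<Rightarrow> complex" where
  "scheme_eigenvalue d P c i = (\<Sum>j\<le>d. c j * P i j)"

lemma first_eigenmatrixE:
  assumes "first_eigenmatrix n d A P"
  obtains E where "nonzero_orthogonal_idempotents n d E" "lin_comb n d (\<lambda>_. 1) E = 1\<^sub>m n"
    "\<And>c. lin_comb n d c A = lin_comb n d (scheme_eigenvalue d P c) E"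
proof -
  obtain E where E: "\<forall>i\<le>d. E i \<in> carrier_mat n n" "\<forall>i\<le>d. E i \<noteq> 0\<^sub>m n n"
      "\<forall>i\<le>d. \<forall>j\<le>d. E i * E j = (if i = j then E i else 0\<^sub>m n n)"
      "lin_comb n d (\<lambda>_. 1) E = 1\<^sub>m n"
    and A: "\<forall>j\<le>d. A j = lin_comb n d (\<lambda>i. P i j) E"
    using assms unfolding first_eigenmatrix_def by blast
  from E(1-3) have "nonzero_orthogonal_idempotents n d E" by unfold_locales auto
  moreover have "lin_comb n d c A = lin_comb n d (scheme_eigenvalue d P c) E" for c
    using lin_comb_lin_comb[of d A n P E] A unfolding scheme_eigenvalue_def by blast
  ultimately show ?thesis using E(4) that by blast
qed

lemma type_II_lin_comb_iff:
  assumes scheme: "sym_assoc_scheme n d A" and eigenmatrix: "first_eigenmatrix n d A P"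
    and w: "\<And>i. i \<le> d \<Longrightarrow> w i \<noteq> 0"
  shows "type_II n (lin_comb n d w A) \<longleftrightarrow>
    (\<forall>i\<le>d. scheme_eigenvalue d P w i * scheme_eigenvalue d P (\<lambda>j. inverse (w j)) i = of_nat n)"
proof -
  let ?W = "lin_comb n d w A" and ?V = "lin_comb n d (\<lambda>i. inverse (w i)) A"
  obtain E where idempotents: "nonzero_orthogonal_idempotents n d E"
    and one: "lin_comb n d (\<lambda>_. 1) E = 1\<^sub>m n"
    and spectral: "\<And>c. lin_comb n d c A = lin_comb n d (scheme_eigenvalue d P c) E"
    using first_eigenmatrixE[OF eigenmatrix] by blast
  interpret nonzero_orthogonal_idempotents n d E by (rule idempotents)
  have "?W $$ (a, b) \<noteq> 0" if "a < n" "b < n" for a b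
    using sym_assoc_scheme_entryE[OF scheme that] w by metis
  then have "type_II n ?W \<longleftrightarrow> ?W * ?V = of_nat n \<cdot>\<^sub>m 1\<^sub>m n"
    unfolding type_II_def entry_inv_lin_comb[OF scheme] transpose_lin_comb_scheme[OF scheme]
    by auto
  also have "of_nat n \<cdot>\<^sub>m 1\<^sub>m n = lin_comb n d (\<lambda>_. of_nat n) E"
    unfolding one[symmetric] smult_lin_comb by simp
  finally show ?thesis
    unfolding spectral lin_comb_mult_lin_comb lin_comb_eq_iff .
qed

subsection \<open>The type-II equations\<close>

lemma add_reciprocal_eq_iff:
  fixes a t :: "'a :: field"
  assumes "a \<noteq> 0"
  shows "a + 1 / a = t \<longleftrightarrow> a\<^sup>2 + 1 = t * a"
  using assms by (auto simp: field_simps power2_eq_square)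

lemma add_reciprocal_eq_divide_iff:
  fixes a p m :: "'a :: field"
  assumes "a \<noteq> 0" "m \<noteq> 0"
  shows "a + 1 / a = p / m \<longleftrightarrow> m * (a\<^sup>2 + 1) = p * a"
  unfolding add_reciprocal_eq_iff[OF assms(1)] using assms(2) by (auto simp: field_simps)

definition theta0 :: "'a :: field_char_0 \<Rightarrow> 'a \<Rightarrow> 'a \<Rightarrow> 'a \<Rightarrow> 'a" where
  "theta0 x a b c = 1 + (x\<^sup>2 / 2 - x) * a + x\<^sup>2 / 2 * b + (x - 2) * c"

definition theta1 :: "'a :: field_char_0 \<Rightarrow> 'a \<Rightarrow> 'a \<Rightarrow> 'a \<Rightarrow> 'a" where
  "theta1 x a b c = 1 + x / 2 * a - x / 2 * b - c"

definition theta2 :: "'a :: field_char_0 \<Rightarrow> 'a \<Rightarrow> 'a \<Rightarrow> 'a \<Rightarrow> 'a" where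
  "theta2 x a b c = 1 + (1 - x / 2) * a - x / 2 * b + (x - 2) * c"

definition reciprocal_product :: "('a :: field \<Rightarrow> 'a \<Rightarrow> 'a \<Rightarrow> 'a) \<Rightarrow> 'a \<Rightarrow> 'a \<Rightarrow> 'a \<Rightarrow> 'a" where
  "reciprocal_product f a b c = f a b c * f (inverse a) (inverse b) (inverse c)"

text \<open>The eigenvalue of row 3 of \<open>P\<close> is \<open>theta1 x b a c\<close>.\<close>

definition type_II_equations :: "'a :: field_char_0 \<Rightarrow> 'a \<Rightarrow> 'a \<Rightarrow> 'a \<Rightarrow> bool" where
  "type_II_equations x a b c \<longleftrightarrow>
     reciprocal_product (theta0 x) a b c = x\<^sup>2 - 1 \<and>
     reciprocal_product (theta1 x) a b c = x\<^sup>2 - 1 \<and>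
     reciprocal_product (theta2 x) a b c = x\<^sup>2 - 1 \<and>
     reciprocal_product (theta1 x) b a c = x\<^sup>2 - 1"

text \<open>The trace of \<open>W (W\<^sup>(\<^sup>-\<^sup>))\<^sup>T\<close> is \<open>n\<^sup>2\<close> for every \<open>W\<close> with nonzero entries; the
  coefficients here are twice the multiplicities of the eigenspaces.\<close>

lemma trace_identity:
  fixes x a b c :: "'a :: field_char_0"
  assumes "a \<noteq> 0" "b \<noteq> 0" "c \<noteq> 0"
  shows "2 * reciprocal_product (theta0 x) a b c
      + (x - 2) * (x + 1) * reciprocal_product (theta1 x) a b c
      + 2 * x * reciprocal_product (theta2 x) a b c
      + (x - 2) * (x + 1) * reciprocal_product (theta1 x) b a c = 2 * (x\<^sup>2 - 1)\<^sup>2"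
  using assms unfolding reciprocal_product_def theta0_def theta1_def theta2_def
  by (simp add: field_simps power2_eq_square)

lemma reciprocal_product_theta1_diff:
  fixes x a b c :: "'a :: field_char_0"
  assumes "a \<noteq> 0" "b \<noteq> 0" "c \<noteq> 0"
  shows "a * b * c * (reciprocal_product (theta1 x) a b c - reciprocal_product (theta1 x) b a c)
      = x * (a - b) * (c - 1) * (c + a * b)"
  using assms unfolding reciprocal_product_def theta1_def
  by (simp add: field_simps power2_eq_square)

definition row13_poly :: "'a :: field_char_0 \<Rightarrow> 'a \<Rightarrow> 'a \<Rightarrow> 'a \<Rightarrow> 'a" where
  "row13_poly x a b c = x\<^sup>2 * c * (a + b)\<^sup>2 + 4 * a * b * (c\<^sup>2 - 3 * c + 1)"

lemma reciprocal_product_theta1_sum: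
  fixes x a b c :: "'a :: field_char_0"
  assumes "a \<noteq> 0" "b \<noteq> 0" "c \<noteq> 0"
  shows "2 * a * b * c * (2 * (x\<^sup>2 - 1)
      - (reciprocal_product (theta1 x) a b c + reciprocal_product (theta1 x) b a c)) = row13_poly x a b c"
  using assms unfolding reciprocal_product_def theta1_def row13_poly_def
  by (simp add: field_simps power2_eq_square)

definition row2_poly :: "'a :: field_char_0 \<Rightarrow> 'a \<Rightarrow> 'a \<Rightarrow> 'a \<Rightarrow> 'a" where
  "row2_poly x a b c = (2 - (x - 2) * a - x * b + 2 * (x - 2) * c)
     * (2 * a * b * c - (x - 2) * b * c - x * a * c + 2 * (x - 2) * a * b)
     - 4 * (x\<^sup>2 - 1) * a * b * c"

lemma reciprocal_product_theta2:
  fixes x a b c :: "'a :: field_char_0"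
  assumes "a \<noteq> 0" "b \<noteq> 0" "c \<noteq> 0"
  shows "4 * a * b * c * (reciprocal_product (theta2 x) a b c - (x\<^sup>2 - 1)) = row2_poly x a b c"
  using assms unfolding reciprocal_product_def theta2_def row2_poly_def
  by (simp add: field_simps power2_eq_square)

lemma type_II_equations_iff_polynomials:
  fixes x a b c :: "'a :: field_char_0"
  assumes nz: "a \<noteq> 0" "b \<noteq> 0" "c \<noteq> 0" "x \<noteq> 0"
  shows "type_II_equations x a b c \<longleftrightarrow>
    row2_poly x a b c = 0 \<and> row13_poly x a b c = 0 \<and> (a = b \<or> c = 1 \<or> c = - (a * b))"
proof -
  define n where "n = x\<^sup>2 - 1"
  define R0 R1 R2 R3 where "R0 = reciprocal_product (theta0 x) a b c"
    and "R1 = reciprocal_product (theta1 x) a b c"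
    and "R2 = reciprocal_product (theta2 x) a b c"
    and "R3 = reciprocal_product (theta1 x) b a c"
  note defs = n_def R0_def R1_def R2_def R3_def
  have R0: "R0 = n" if "R1 = n" "R2 = n" "R3 = n"
    using trace_identity[OF nz(1-3), of x, folded defs] that n_def by Groebner_Basis.algebra
  have R2: "R2 = n \<longleftrightarrow> row2_poly x a b c = 0"
    using reciprocal_product_theta2[OF nz(1-3), of x, folded defs, symmetric] nz by simp
  have sum: "R1 + R3 = 2 * n \<longleftrightarrow> row13_poly x a b c = 0"
    using reciprocal_product_theta1_sum[OF nz(1-3), of x, folded defs, symmetric] nz by auto
  have "R1 = R3 \<longleftrightarrow> x * (a - b) * (c - 1) * (c + a * b) = 0"
    using reciprocal_product_theta1_diff[OF nz(1-3), of x, folded defs, symmetric] nz by simp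
  then have diff: "R1 = R3 \<longleftrightarrow> a = b \<or> c = 1 \<or> c = - (a * b)"
    using nz by (simp add: eq_neg_iff_add_eq_0)
  have "R1 = n \<and> R3 = n \<longleftrightarrow> R1 + R3 = 2 * n \<and> R1 = R3"
    by (auto simp: mult_2[symmetric])
  then show ?thesis
    unfolding type_II_equations_def defs[symmetric] R2[symmetric] sum[symmetric] diff[symmetric]
    using R0 by blast
qed

subsection \<open>The components of the solution set\<close>

lemma equal_weights_solutions_iff:
  fixes x a c :: "'a :: field_char_0"
  assumes nz: "a \<noteq> 0" "c \<noteq> 0" "x - 1 \<noteq> 0" "x\<^sup>2 - 2 * x - 1 \<noteq> 0"
  shows "row2_poly x a a c = 0 \<and> row13_poly x a a c = 0 \<longleftrightarrow>
    c + 1 / c + x\<^sup>2 - 3 = 0 \<and> (a = c \<or> a = (- (x - 3) * c + (x - 1)) / (x\<^sup>2 - 2 * x - 1))"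
proof -
  let ?m = "x\<^sup>2 - 2 * x - 1" and ?Q = "c\<^sup>2 + (x\<^sup>2 - 3) * c + 1"
  have Q: "c + 1 / c + x\<^sup>2 - 3 = 0 \<longleftrightarrow> ?Q = 0"
    using nz by (simp add: field_simps power2_eq_square)
  have "row13_poly x a a c = 4 * a\<^sup>2 * ?Q"
    unfolding row13_poly_def by Groebner_Basis.algebra
  then have row13: "row13_poly x a a c = 0 \<longleftrightarrow> ?Q = 0" using nz by simp
  have row2: "row2_poly x a a c = 0 \<longleftrightarrow> a = c \<or> a = (- (x - 3) * c + (x - 1)) / ?m"
    if c: "?Q = 0"
  proof -
    have "c + x - 2 \<noteq> 0"
    proof
      assume "c + x - 2 = 0"
      then have "(x - 1) * ?m = 0" using c by Groebner_Basis.algebra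
      then show False using nz by simp
    qed
    moreover have "?m * row2_poly x a a c =
        - 4 * a * (x - 1) * (a - c) * (c + x - 2) * (?m * a - (- (x - 3) * c + (x - 1)))"
      using c unfolding row2_poly_def by Groebner_Basis.algebra
    ultimately have "row2_poly x a a c = 0 \<longleftrightarrow> a - c = 0 \<or> ?m * a - (- (x - 3) * c + (x - 1)) = 0"
      using nz by (metis mult_eq_0_iff neg_equal_0_iff_equal zero_neq_numeral)
    also have "\<dots> \<longleftrightarrow> a = c \<or> a * ?m = - (x - 3) * c + (x - 1)"
      by (simp add: mult.commute)
    also have "\<dots> \<longleftrightarrow> a = c \<or> a = (- (x - 3) * c + (x - 1)) / ?m"
      using nz(4) by (simp only: nonzero_eq_divide_eq not_False_eq_True)
    finally show ?thesis .
  qed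
  show ?thesis unfolding Q row13 using row2 by blast
qed

text \<open>With \<open>u = x (a + b)\<close> the row 1 equation is \<open>u\<^sup>2 = 4ab\<close>; modulo it, the row 2
  polynomial is a multiple of \<open>(a - 1) (u + 2) (u - 2a)\<close>.\<close>

lemma third_weight_one_solutions_iff:
  fixes x a b :: "'a :: field_char_0"
  assumes nz: "a \<noteq> 0" "b \<noteq> 0" "x \<noteq> 0" "x - 1 \<noteq> 0"
  shows "row2_poly x a b 1 = 0 \<and> row13_poly x a b 1 = 0 \<longleftrightarrow>
    a = 1 \<and> b + 1 / b = - 2 * (x\<^sup>2 - 2) / x\<^sup>2 \<or> a + 1 / a = - 2 / x \<and> b = 1 / a"
proof -
  define u where "u = x * (a + b)"
  have row13: "row13_poly x a b 1 = 0 \<longleftrightarrow> u\<^sup>2 = 4 * a * b"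
    unfolding row13_poly_def u_def by (simp add: power_mult_distrib)
  have row2: "row2_poly x a b 1 = 0 \<longleftrightarrow> a = 1 \<or> u = - 2" if u: "u\<^sup>2 = 4 * a * b"
  proof -
    have "u \<noteq> 0" using u nz by auto
    moreover have "u * row2_poly x a b 1 = - 2 * (x - 1) * b * (a - 1) * (u + 2) * (u - 2 * a)"
      using u unfolding row2_poly_def u_def by Groebner_Basis.algebra
    moreover have "u - 2 * a \<noteq> 0"
    proof
      assume eq: "u - 2 * a = 0"
      then have "4 * a * (a - b) = 0" using u by Groebner_Basis.algebra
      then have "a = b" using nz by simp
      then have "2 * a * (x - 1) = 0" using eq unfolding u_def by (simp add: algebra_simps)
      then show False using nz by simp
    qed
    ultimately have "row2_poly x a b 1 = 0 \<longleftrightarrow> a - 1 = 0 \<or> u + 2 = 0"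
      using nz by (metis mult_eq_0_iff neg_equal_0_iff_equal zero_neq_numeral)
    then show ?thesis by (simp add: eq_neg_iff_add_eq_0)
  qed
  have case_iv: "u\<^sup>2 = 4 * a * b \<longleftrightarrow> b + 1 / b = - 2 * (x\<^sup>2 - 2) / x\<^sup>2" if "a = 1"
    using nz add_reciprocal_eq_divide_iff[of b "x\<^sup>2" "- 2 * (x\<^sup>2 - 2)"]
    unfolding u_def that by (auto simp: algebra_simps power2_eq_square)
  have "u\<^sup>2 = 4 * a * b \<and> u = - 2 \<longleftrightarrow> u = - 2 \<and> a * b = 1"
    by auto
  also have "\<dots> \<longleftrightarrow> u = - 2 \<and> b = 1 / a"
    using nz by (simp add: eq_divide_eq mult.commute)
  also have "\<dots> \<longleftrightarrow> (a + 1 / a) * x = - 2 \<and> b = 1 / a"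
    unfolding u_def by (auto simp: mult.commute)
  also have "\<dots> \<longleftrightarrow> a + 1 / a = - 2 / x \<and> b = 1 / a"
    unfolding nonzero_eq_divide_eq[OF nz(3)] ..
  finally have case_v: "u\<^sup>2 = 4 * a * b \<and> u = - 2 \<longleftrightarrow> a + 1 / a = - 2 / x \<and> b = 1 / a" .
  show ?thesis unfolding row13 case_v[symmetric] using row2 case_iv by blast
qed

definition residual_conic :: "'a :: field_char_0 \<Rightarrow> 'a \<Rightarrow> 'a \<Rightarrow> 'a" where
  "residual_conic x a b = 4 * (1 + 3 * a * b + a\<^sup>2 * b\<^sup>2) - x\<^sup>2 * (a + b)\<^sup>2"

definition residual_slope :: "'a :: field_char_0 \<Rightarrow> 'a \<Rightarrow> 'a" where
  "residual_slope x a = - 2 * a\<^sup>2 + (x - 4) * a + x"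

definition residual_offset :: "'a :: field_char_0 \<Rightarrow> 'a \<Rightarrow> 'a" where
  "residual_offset x a = x * a\<^sup>2 + (x - 4) * a - 2"

definition residual_line :: "'a :: field_char_0 \<Rightarrow> 'a \<Rightarrow> 'a \<Rightarrow> 'a" where
  "residual_line x a b = residual_slope x a * b + residual_offset x a"

lemmas residual_line_defs = residual_line_def residual_slope_def residual_offset_def

lemma third_weight_neg_product_solutions_iff:
  fixes x a b :: "'a :: field_char_0"
  assumes nz: "a \<noteq> 0" "b \<noteq> 0" "x - 1 \<noteq> 0" "x\<^sup>2 - 4 \<noteq> 0"
  shows "row2_poly x a b (- (a * b)) = 0 \<and> row13_poly x a b (- (a * b)) = 0 \<longleftrightarrow>
    a + 1 / a = 2 * (x\<^sup>2 - 6) / (x\<^sup>2 - 4) \<and> b = - 1 \<or>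
    residual_conic x a b = 0 \<and> residual_line x a b = 0"
proof -
  have "row13_poly x a b (- (a * b)) = a * b * residual_conic x a b"
    unfolding row13_poly_def residual_conic_def by Groebner_Basis.algebra
  then have row13: "row13_poly x a b (- (a * b)) = 0 \<longleftrightarrow> residual_conic x a b = 0"
    using nz by simp
  have row2: "row2_poly x a b (- (a * b)) = 0 \<longleftrightarrow> b = - 1 \<or> residual_line x a b = 0"
    if conic: "residual_conic x a b = 0"
  proof -
    have "row2_poly x a b (- (a * b)) = - 2 * a * b * (x - 1) * (b + 1) * residual_line x a b"
      using conic unfolding row2_poly_def residual_conic_def residual_line_defs
      by Groebner_Basis.algebra
    then show ?thesis using nz by (auto simp: eq_neg_iff_add_eq_0)
  qed
  have "residual_conic x a (- 1) = 2 * (x\<^sup>2 - 6) * a - (x\<^sup>2 - 4) * (a\<^sup>2 + 1)"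
    unfolding residual_conic_def by Groebner_Basis.algebra
  then have case_iii: "residual_conic x a (- 1) = 0 \<longleftrightarrow> a + 1 / a = 2 * (x\<^sup>2 - 6) / (x\<^sup>2 - 4)"
    unfolding add_reciprocal_eq_divide_iff[OF nz(1,4)] by auto
  show ?thesis unfolding row13 using row2 case_iii by blast
qed

subsection \<open>The residual solutions\<close>

definition residual_quadratic :: "'a :: field_char_0 \<Rightarrow> 'a \<Rightarrow> 'a" where
  "residual_quadratic x t = x * (x + 1) * t\<^sup>2 + (x - 1) * (x - 2) * t - 2 * (x - 1) * (2 * x + 7)"

text \<open>If \<open>m b + k = 0\<close>, the left-hand side is \<open>m\<^sup>2\<close> times \<open>residual_conic x a b\<close>.\<close>

lemma residual_resultant:
  fixes x a :: "'a :: field_char_0"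
  assumes "a \<noteq> 0"
  defines "m \<equiv> residual_slope x a" and "k \<equiv> residual_offset x a"
  shows "4 * (m\<^sup>2 - 3 * a * m * k + a\<^sup>2 * k\<^sup>2) - x\<^sup>2 * (a * m - k)\<^sup>2
    = - 8 * a ^ 3 * residual_quadratic x (a + 1 / a)"
proof -
  have "a\<^sup>2 + 1 = (a + 1 / a) * a"
    using add_reciprocal_eq_iff[OF assms(1)] by blast
  then show ?thesis
    unfolding m_def k_def residual_slope_def residual_offset_def residual_quadratic_def
    by Groebner_Basis.algebra
qed

lemma residual_quadratic_root_sq_neq_one:
  fixes x a :: "'a :: field_char_0"
  assumes root: "residual_quadratic x (a + 1 / a) = 0" and nz: "x - 3 \<noteq> 0" "x\<^sup>2 - 5 \<noteq> 0"
  shows "a\<^sup>2 - 1 \<noteq> 0"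
proof
  have "residual_quadratic x 2 = 2 * (x - 3)\<^sup>2" "residual_quadratic x (- 2) = - 2 * (x\<^sup>2 - 5)"
    unfolding residual_quadratic_def by Groebner_Basis.algebra+
  moreover assume "a\<^sup>2 - 1 = 0"
  then have "a = 1 \<or> a = - 1" by (simp add: power2_eq_1_iff)
  ultimately show False using root nz by auto
qed

lemma residual_slope_nonzero:
  fixes x a :: "'a :: field_char_0"
  assumes root: "residual_quadratic x (a + 1 / a) = 0"
    and nz: "a \<noteq> 0" "x \<noteq> 0" "x + 2 \<noteq> 0" "x - 3 \<noteq> 0" "x\<^sup>2 - 5 \<noteq> 0"
  shows "residual_slope x a \<noteq> 0"
proof
  assume slope: "residual_slope x a = 0"
  have "residual_offset x a - residual_slope x a = (x + 2) * (a\<^sup>2 - 1)"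
    unfolding residual_offset_def residual_slope_def by Groebner_Basis.algebra
  then have "residual_offset x a \<noteq> 0"
    using slope residual_quadratic_root_sq_neq_one[OF root] nz by auto
  moreover have "(residual_offset x a)\<^sup>2 * ((x - 2 * a) * (x + 2 * a)) = 0"
    using residual_resultant[OF nz(1), of x] unfolding slope root
    by (auto simp: algebra_simps power2_eq_square)
  ultimately consider "x = 2 * a" | "x = - 2 * a"
    by (auto simp: eq_neg_iff_add_eq_0)
  then show False
  proof cases
    case 1
    have "residual_slope x a = - x"
      unfolding residual_slope_def 1 by Groebner_Basis.algebra
    then show False using slope nz by simp
  next
    case 2
    have "residual_slope x a = - 2 * a * (3 - x)"
      unfolding residual_slope_def 2 by Groebner_Basis.algebra
    then show False using slope nz by simp
  qed
qed

lemma residual_conic_and_line_iff: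
  fixes x a b :: "'a :: field_char_0"
  assumes nz: "a \<noteq> 0" "x \<noteq> 0" "x + 2 \<noteq> 0" "x - 3 \<noteq> 0" "x\<^sup>2 - 5 \<noteq> 0"
  shows "residual_conic x a b = 0 \<and> residual_line x a b = 0 \<longleftrightarrow>
    residual_quadratic x (a + 1 / a) = 0 \<and> residual_line x a b = 0"
proof -
  have "(residual_slope x a)\<^sup>2 * residual_conic x a b = - 8 * a ^ 3 * residual_quadratic x (a + 1 / a)"
    if "residual_line x a b = 0"
    using that residual_resultant[OF nz(1), of x]
    unfolding residual_conic_def residual_line_def by Groebner_Basis.algebra
  then show ?thesis using residual_slope_nonzero[OF _ nz] nz by auto
qed

text \<open>\<open>alpha\<^sub>i\<^sub>j\<close> is the common value of \<open>w\<^sub>i / w\<^sub>j + w\<^sub>j / w\<^sub>i\<close> on the residual solutions, where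
  \<open>w\<^sub>0 = 1\<close>; since \<open>w\<^sub>1 w\<^sub>2 = - w\<^sub>3\<close> there, \<open>alpha\<^sub>1\<^sub>3 = - alpha\<^sub>0\<^sub>2\<close>.\<close>

definition alpha01 :: "'a :: field_char_0 \<Rightarrow> 'a \<Rightarrow> 'a" where
  "alpha01 x r = (- (x - 1) * (x - 2) + (x + 2) * r) / (2 * x * (x + 1))"

definition alpha02 :: "'a :: field_char_0 \<Rightarrow> 'a \<Rightarrow> 'a" where
  "alpha02 x r = ((x + 2) * (x - 1) - (x - 2) * r) / (2 * x * (x - 3))"

definition alpha03 :: "'a :: field_char_0 \<Rightarrow> 'a \<Rightarrow> 'a" where
  "alpha03 x r = (5 * x\<^sup>2 - 2 * x - 19 - (x - 1) * r) / (2 * (x + 1) * (x - 3))"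

definition alpha12 :: "'a :: field_char_0 \<Rightarrow> 'a \<Rightarrow> 'a" where
  "alpha12 x r = 2 * (- (x ^ 4) + 2 * x ^ 3 + 4 * x\<^sup>2 - 10 * x + 1 + (x - 1) * r)
     / (x\<^sup>2 * (x + 1) * (x - 3))"

lemma alpha01_cleared:
  fixes x r :: "'a :: field_char_0"
  assumes "x \<noteq> 0" "x + 1 \<noteq> 0"
  shows "2 * x * (x + 1) * alpha01 x r = - (x - 1) * (x - 2) + (x + 2) * r"
  using assms unfolding alpha01_def by simp

lemma
  fixes x r :: "'a :: field_char_0"
  assumes nz: "x \<noteq> 0" "x + 1 \<noteq> 0" "x - 3 \<noteq> 0"
  shows alpha02_cleared: "2 * x * (x - 3) * alpha02 x r = (x + 2) * (x - 1) - (x - 2) * r"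
    and alpha03_cleared: "2 * (x + 1) * (x - 3) * alpha03 x r = 5 * x\<^sup>2 - 2 * x - 19 - (x - 1) * r"
    and alpha12_cleared: "x\<^sup>2 * (x + 1) * (x - 3) * alpha12 x r
      = 2 * (- (x ^ 4) + 2 * x ^ 3 + 4 * x\<^sup>2 - 10 * x + 1 + (x - 1) * r)"
  using nz unfolding alpha02_def alpha03_def alpha12_def by (simp_all del: distrib_left_numeral)

lemma residual_quadratic_eq_0_iff:
  fixes x s t :: "'a :: field_char_0"
  assumes nz: "x \<noteq> 0" "x + 1 \<noteq> 0" and s: "s\<^sup>2 = (17 * x - 1) * (x - 1)"
  shows "residual_quadratic x t = 0 \<longleftrightarrow> (\<exists>r. r\<^sup>2 = (17 * x - 1) * (x - 1) \<and> t = alpha01 x r)"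
proof -
  let ?v = "2 * x * (x + 1) * t + (x - 1) * (x - 2)"
  have alpha01: "t = alpha01 x r \<longleftrightarrow> ?v - (x + 2) * r = 0" for r
  proof -
    have "2 * x * (x + 1) * (t - alpha01 x r) = ?v - (x + 2) * r"
      using alpha01_cleared[OF nz, of r] by Groebner_Basis.algebra
    then show ?thesis using nz by auto
  qed
  have "4 * x * (x + 1) * residual_quadratic x t = (?v - (x + 2) * s) * (?v + (x + 2) * s)"
    using s unfolding residual_quadratic_def by Groebner_Basis.algebra
  from this[symmetric] have "residual_quadratic x t = 0 \<longleftrightarrow> (?v - (x + 2) * s) * (?v + (x + 2) * s) = 0"
    using nz by simp
  also have "\<dots> \<longleftrightarrow> ?v - (x + 2) * s = 0 \<or> ?v - (x + 2) * (- s) = 0"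
    by simp
  also have "\<dots> \<longleftrightarrow> (\<exists>r. r\<^sup>2 = s\<^sup>2 \<and> t = alpha01 x r)"
    unfolding alpha01 power2_eq_iff by blast
  finally show ?thesis unfolding s .
qed

text \<open>The relation expresses
  \<open>(w\<^sub>1 + 1 / w\<^sub>1) (w\<^sub>2 + 1 / w\<^sub>2) = w\<^sub>1 / w\<^sub>2 + w\<^sub>2 / w\<^sub>1 + w\<^sub>1 w\<^sub>2 + 1 / (w\<^sub>1 w\<^sub>2)\<close> with \<open>w\<^sub>1 w\<^sub>2 = - w\<^sub>3\<close>.\<close>

lemma alpha12_eq:
  fixes x r :: "'a :: field_char_0"
  assumes nz: "x \<noteq> 0" "x + 1 \<noteq> 0" "x - 3 \<noteq> 0" and r: "r\<^sup>2 = (17 * x - 1) * (x - 1)"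
  shows "alpha12 x r = alpha02 x r * alpha01 x r + alpha03 x r"
proof -
  have "4 * x\<^sup>2 * (x + 1) * (x - 3) * (alpha12 x r - (alpha02 x r * alpha01 x r + alpha03 x r)) = 0"
    using alpha01_cleared[OF nz(1,2), of r] alpha02_cleared[OF nz, of r]
      alpha03_cleared[OF nz, of r] alpha12_cleared[OF nz, of r] r by Groebner_Basis.algebra
  then show ?thesis using nz by simp
qed

lemma residual_slope_offset_proportional:
  fixes x r a :: "'a :: field_char_0"
  assumes nz: "a \<noteq> 0" "x \<noteq> 0" "x + 1 \<noteq> 0" "x - 3 \<noteq> 0"
    and r: "r\<^sup>2 = (17 * x - 1) * (x - 1)" and a: "a + 1 / a = alpha01 x r"
  shows "residual_slope x a * (a\<^sup>2 - 1) = - (residual_offset x a * (alpha12 x r * a - alpha02 x r))"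
proof -
  have "a\<^sup>2 + 1 = alpha01 x r * a"
    using a unfolding add_reciprocal_eq_iff[OF nz(1)] .
  then have square: "2 * x * (x + 1) * (a\<^sup>2 + 1) = (- (x - 1) * (x - 2) + (x + 2) * r) * a"
    using alpha01_cleared[OF nz(2,3), of r] by Groebner_Basis.algebra
  have denominator: "2 * x\<^sup>2 * (x + 1) * (x - 3) * (alpha12 x r * a - alpha02 x r)
      = 4 * (- (x ^ 4) + 2 * x ^ 3 + 4 * x\<^sup>2 - 10 * x + 1 + (x - 1) * r) * a
        - x * (x + 1) * ((x + 2) * (x - 1) - (x - 2) * r)"
    using alpha02_cleared[OF nz(2-4), of r] alpha12_cleared[OF nz(2-4), of r]
    by Groebner_Basis.algebra
  have "2 * x\<^sup>2 * (x + 1)\<^sup>2 * (x - 3) * (residual_slope x a * (a\<^sup>2 - 1)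
      + residual_offset x a * (alpha12 x r * a - alpha02 x r)) = 0"
    using square denominator r unfolding residual_slope_def residual_offset_def by Groebner_Basis.algebra
  then show ?thesis using nz by (simp add: eq_neg_iff_add_eq_0)
qed

definition residual_branch :: "'a :: field_char_0 \<Rightarrow> 'a \<Rightarrow> 'a \<Rightarrow> 'a \<Rightarrow> 'a \<Rightarrow> bool" where
  "residual_branch x r a b c \<longleftrightarrow> a + 1 / a = alpha01 x r \<and>
     b = (a\<^sup>2 - 1) / (alpha12 x r * a - alpha02 x r) \<and>
     c = (a\<^sup>2 - 1) / (- alpha02 x r * a - alpha03 x r)"

lemma residual_branch_iff:
  fixes x a b c :: "'a :: field_char_0"
  assumes nz: "a \<noteq> 0" "x \<noteq> 0" "x + 1 \<noteq> 0" "x + 2 \<noteq> 0" "x - 3 \<noteq> 0" "x\<^sup>2 - 5 \<noteq> 0"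
    and r: "r\<^sup>2 = (17 * x - 1) * (x - 1)"
  shows "residual_branch x r a b c \<longleftrightarrow>
    a + 1 / a = alpha01 x r \<and> residual_line x a b = 0 \<and> c = - (a * b)"
proof (cases "a + 1 / a = alpha01 x r")
  case True
  define v where "v = alpha12 x r * a - alpha02 x r"
  have square: "a\<^sup>2 + 1 = alpha01 x r * a"
    using True unfolding add_reciprocal_eq_iff[OF nz(1)] .
  have root: "residual_quadratic x (a + 1 / a) = 0"
    unfolding residual_quadratic_eq_0_iff[OF nz(2,3) r] using True r by blast
  have slope: "residual_slope x a \<noteq> 0" and square_neq_one: "a\<^sup>2 - 1 \<noteq> 0"
    using residual_slope_nonzero[OF root] residual_quadratic_root_sq_neq_one[OF root] nz by auto
  have proportional: "residual_slope x a * (a\<^sup>2 - 1) = - (residual_offset x a * v)"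
    unfolding v_def by (rule residual_slope_offset_proportional[OF nz(1-3,5) r True])
  then have v: "v \<noteq> 0" using slope square_neq_one by auto
  have "residual_slope x a * (b * v - (a\<^sup>2 - 1)) = residual_line x a b * v"
    using proportional unfolding residual_line_def by Groebner_Basis.algebra
  then have "residual_line x a b = 0 \<longleftrightarrow> b * v = a\<^sup>2 - 1"
    using slope v by auto
  also have "\<dots> \<longleftrightarrow> b = (a\<^sup>2 - 1) / v"
    using v by (simp add: eq_divide_eq)
  finally have line: "residual_line x a b = 0 \<longleftrightarrow> b = (a\<^sup>2 - 1) / v" .
  have "v = - (a * (- alpha02 x r * a - alpha03 x r))"
    using alpha12_eq[OF nz(2,3,5) r] square unfolding v_def by Groebner_Basis.algebra
  then have "(a\<^sup>2 - 1) / (- alpha02 x r * a - alpha03 x r) = - (a * ((a\<^sup>2 - 1) / v))"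
    using nz(1) by simp
  then show ?thesis
    unfolding residual_branch_def line v_def[symmetric] using True by auto
qed (simp add: residual_branch_def)

lemma residual_solutions_iff:
  fixes x s a b c :: "'a :: field_char_0"
  assumes nz: "a \<noteq> 0" "x \<noteq> 0" "x + 1 \<noteq> 0" "x + 2 \<noteq> 0" "x - 3 \<noteq> 0" "x\<^sup>2 - 5 \<noteq> 0"
    and s: "s\<^sup>2 = (17 * x - 1) * (x - 1)"
  shows "residual_conic x a b = 0 \<and> residual_line x a b = 0 \<and> c = - (a * b) \<longleftrightarrow>
    (\<exists>r. r\<^sup>2 = (17 * x - 1) * (x - 1) \<and> residual_branch x r a b c)"
  using residual_conic_and_line_iff[OF nz(1,2,4-6), of b]
    residual_quadratic_eq_0_iff[OF nz(2,3) s, of "a + 1 / a"] residual_branch_iff[OF nz]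
  by blast

lemma type_II_equations_solutions_iff:
  fixes x s a b c :: "'a :: field_char_0"
  assumes w: "a \<noteq> 0" "b \<noteq> 0" "c \<noteq> 0"
    and nz: "x \<noteq> 0" "x - 1 \<noteq> 0" "x + 1 \<noteq> 0" "x + 2 \<noteq> 0" "x - 3 \<noteq> 0"
      "x\<^sup>2 - 2 * x - 1 \<noteq> 0" "x\<^sup>2 - 4 \<noteq> 0" "x\<^sup>2 - 5 \<noteq> 0"
    and s: "s\<^sup>2 = (17 * x - 1) * (x - 1)"
  shows "type_II_equations x a b c \<longleftrightarrow>
      a = b \<and> b = c \<and> c + 1 / c + x\<^sup>2 - 3 = 0
    \<or> c + 1 / c + x\<^sup>2 - 3 = 0 \<and> a = b \<and> b = (- (x - 3) * c + (x - 1)) / (x\<^sup>2 - 2 * x - 1)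
    \<or> a + 1 / a = 2 * (x\<^sup>2 - 6) / (x\<^sup>2 - 4) \<and> b = - 1 \<and> c = a
    \<or> a = 1 \<and> c = 1 \<and> b + 1 / b = - 2 * (x\<^sup>2 - 2) / x\<^sup>2
    \<or> a + 1 / a = - 2 / x \<and> b = 1 / a \<and> c = 1
    \<or> (\<exists>r. r\<^sup>2 = (17 * x - 1) * (x - 1) \<and> residual_branch x r a b c)"
proof -
  let ?E = "row2_poly x a b c = 0 \<and> row13_poly x a b c = 0"
  have equal: "?E \<and> a = b \<longleftrightarrow> a = b \<and> c + 1 / c + x\<^sup>2 - 3 = 0 \<and>
      (b = c \<or> b = (- (x - 3) * c + (x - 1)) / (x\<^sup>2 - 2 * x - 1))"
    using equal_weights_solutions_iff[OF w(1,3) nz(2,6)] by metis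
  have one: "?E \<and> c = 1 \<longleftrightarrow> c = 1 \<and>
      (a = 1 \<and> b + 1 / b = - 2 * (x\<^sup>2 - 2) / x\<^sup>2 \<or> a + 1 / a = - 2 / x \<and> b = 1 / a)"
    using third_weight_one_solutions_iff[OF w(1,2) nz(1,2)] by metis
  have neg_product: "?E \<and> c = - (a * b) \<longleftrightarrow> c = - (a * b) \<and>
      (a + 1 / a = 2 * (x\<^sup>2 - 6) / (x\<^sup>2 - 4) \<and> b = - 1
       \<or> residual_conic x a b = 0 \<and> residual_line x a b = 0)"
    using third_weight_neg_product_solutions_iff[OF w(1,2) nz(2,7)] by metis
  have case_iii: "c = - (a * b) \<and> b = - 1 \<longleftrightarrow> b = - 1 \<and> c = a" by auto
  show ?thesis
    unfolding type_II_equations_iff_polynomials[OF w nz(1)]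
      residual_solutions_iff[OF w(1) nz(1,3-5,8) s, symmetric]
    using equal one neg_product case_iii by satx
qed

subsection \<open>The scheme with first eigenmatrix \<open>P\<close>\<close>

lemma all_le_3_iff: "(\<forall>i\<le>3. Q i) \<longleftrightarrow> Q 0 \<and> Q 1 \<and> Q 2 \<and> Q (3 :: nat)"
  by (auto simp: le_Suc_eq numeral_eq_Suc)

lemma sum_atMost_3:
  fixes f :: "nat \<Rightarrow> 'a :: comm_monoid_add"
  shows "(\<Sum>i\<le>3. f i) = f 0 + f 1 + f 2 + f 3"
  by (simp add: numeral_eq_Suc)

lemma scheme_eigenvalue_P_thm:
  fixes q :: nat
  assumes "w 0 = 1"
  defines "x \<equiv> of_nat q"
  shows "scheme_eigenvalue 3 (P_thm q) w 0 = theta0 x (w 1) (w 2) (w 3)"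
    and "scheme_eigenvalue 3 (P_thm q) w 1 = theta1 x (w 1) (w 2) (w 3)"
    and "scheme_eigenvalue 3 (P_thm q) w 2 = theta2 x (w 1) (w 2) (w 3)"
    and "scheme_eigenvalue 3 (P_thm q) w 3 = theta1 x (w 2) (w 1) (w 3)"
  unfolding scheme_eigenvalue_def sum_atMost_3 P_thm_def theta0_def theta1_def theta2_def
  by (simp_all add: assms Let_def algebra_simps)

lemma type_II_iff_equations:
  assumes q: "q \<noteq> 0" and scheme: "sym_assoc_scheme (q\<^sup>2 - 1) 3 A"
    and eigenmatrix: "first_eigenmatrix (q\<^sup>2 - 1) 3 A (P_thm q)"
    and nz: "w1 \<noteq> 0" "w2 \<noteq> 0" "w3 \<noteq> 0"
  shows "type_II (q\<^sup>2 - 1) (A 0 + w1 \<cdot>\<^sub>m A 1 + w2 \<cdot>\<^sub>m A 2 + w3 \<cdot>\<^sub>m A 3) \<longleftrightarrow>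
    type_II_equations (of_nat q) w1 w2 w3"
proof -
  define w where "w = (!) [1, w1, w2, w3]"
  have w: "w 0 = 1" "w 1 = w1" "w 2 = w2" "w 3 = w3"
    by (simp_all add: w_def)
  have w_nz: "\<forall>i\<le>3. w i \<noteq> 0"
    unfolding all_le_3_iff w using nz by simp
  have "A 0 + w1 \<cdot>\<^sub>m A 1 + w2 \<cdot>\<^sub>m A 2 + w3 \<cdot>\<^sub>m A 3 = lin_comb (q\<^sup>2 - 1) 3 w A"
  proof -
    have "\<forall>i\<le>3. A i \<in> carrier_mat (q\<^sup>2 - 1) (q\<^sup>2 - 1)"
      using scheme unfolding sym_assoc_scheme_def by blast
    then show ?thesis
      unfolding all_le_3_iff by (intro eq_matI) (auto simp: sum_atMost_3 w w(2)[simplified])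
  qed
  moreover have "of_nat (q\<^sup>2 - 1) = (of_nat q)\<^sup>2 - (1 :: complex)"
    using q by (simp add: of_nat_diff)
  ultimately show ?thesis
    using type_II_lin_comb_iff[OF scheme eigenmatrix w_nz[rule_format]]
    by (simp only: all_le_3_iff scheme_eigenvalue_P_thm w inverse_1 type_II_equations_def
        reciprocal_product_def)
qed

lemma parameter_nondegenerate:
  fixes q :: nat
  assumes "q \<ge> 4"
  defines "x \<equiv> of_nat q :: 'a :: ring_char_0"
  shows "x \<noteq> 0" "x - 1 \<noteq> 0" "x + 1 \<noteq> 0" "x + 2 \<noteq> 0" "x - 3 \<noteq> 0"
    "x\<^sup>2 - 2 * x - 1 \<noteq> 0" "x\<^sup>2 - 4 \<noteq> 0" "x\<^sup>2 - 5 \<noteq> 0"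
proof -
  define k where "k = int q"
  have x: "x = of_int k" by (simp add: x_def k_def)
  have k: "k \<ge> 4" "k * k \<ge> 4 * k" using assms by (auto simp: k_def)
  have "of_int z \<noteq> (0 :: 'a)" if "z > 0" for z using that by simp
  from this[of k] this[of "k - 1"] this[of "k + 1"] this[of "k + 2"] this[of "k - 3"]
    this[of "k * k - 2 * k - 1"] this[of "k * k - 4"] this[of "k * k - 5"]
  show "x \<noteq> 0" "x - 1 \<noteq> 0" "x + 1 \<noteq> 0" "x + 2 \<noteq> 0" "x - 3 \<noteq> 0"
    "x\<^sup>2 - 2 * x - 1 \<noteq> 0" "x\<^sup>2 - 4 \<noteq> 0" "x\<^sup>2 - 5 \<noteq> 0"
    using k unfolding x power2_eq_square by simp_all
qed

lemma ex_sqrt_of_real_iff: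
  fixes D :: real and Q :: "complex \<Rightarrow> bool"
  assumes "D \<ge> 0"
  shows "(\<exists>z. z\<^sup>2 = of_real D \<and> Q z) \<longleftrightarrow> (\<exists>r. r\<^sup>2 = D \<and> Q (of_real r))"
proof
  assume "\<exists>z. z\<^sup>2 = of_real D \<and> Q z"
  then obtain z where z: "z\<^sup>2 = of_real D" "Q z" by blast
  have "of_real D = (complex_of_real (sqrt D))\<^sup>2"
    using assms by (simp flip: of_real_power)
  then have "z = of_real (sqrt D) \<or> z = of_real (- sqrt D)"
    using z(1) by (simp add: power2_eq_iff)
  moreover have "(sqrt D)\<^sup>2 = D" "(- sqrt D)\<^sup>2 = D" using assms by simp_all
  ultimately show "\<exists>r. r\<^sup>2 = D \<and> Q (of_real r)" using z(2) by blast
next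
  assume "\<exists>r. r\<^sup>2 = D \<and> Q (of_real r)"
  then show "\<exists>z. z\<^sup>2 = of_real D \<and> Q z" by (metis of_real_power)
qed

theorem theorem4p1:
  fixes q :: nat and A :: "nat \<Rightarrow> complex mat" and w1 w2 w3 :: complex
  assumes hq: "q \<ge> 4"
    and hscheme: "sym_assoc_scheme (q^2 - 1) 3 A"
    and hP: "first_eigenmatrix (q^2 - 1) 3 A (P_thm q)"
    and hw: "w1 \<noteq> 0" "w2 \<noteq> 0" "w3 \<noteq> 0"
  defines "W \<equiv> A 0 + w1 \<cdot>\<^sub>m A 1 + w2 \<cdot>\<^sub>m A 2 + w3 \<cdot>\<^sub>m A 3"
    and "case_vi \<equiv> (\<exists>r::real. r^2 = (17 * real q - 1) * (real q - 1) \<and>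
           (let x = (of_nat q :: complex);
                a01 = (- (x - 1) * (x - 2) + (x + 2) * of_real r) / (2 * x * (x + 1));
                a02 = ((x + 2) * (x - 1) - (x - 2) * of_real r) / (2 * x * (x - 3));
                a03 = (5 * x^2 - 2 * x - 19 - (x - 1) * of_real r) / (2 * (x + 1) * (x - 3));
                a12 = 2 * (- (x^4) + 2 * x^3 + 4 * x^2 - 10 * x + 1 + (x - 1) * of_real r)
                        / (x^2 * (x + 1) * (x - 3));
                a13 = - a02
            in w1 + 1 / w1 = a01 \<and>
               w2 = (w1^2 - 1) / (a12 * w1 - a02) \<and>
               w3 = (w1^2 - 1) / (a13 * w1 - a03)))"
  shows "(type_II (q^2 - 1) W \<longleftrightarrow>
          (let x = (of_nat q :: complex) in
            (w1 = w2 \<and> w2 = w3 \<and> w3 + 1 / w3 + x^2 - 3 = 0)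
          \<or> (w3 + 1 / w3 + x^2 - 3 = 0 \<and> w1 = w2 \<and>
              w2 = (- (x - 3) * w3 + (x - 1)) / (x^2 - 2 * x - 1))
          \<or> (w1 + 1 / w1 = 2 * (x^2 - 6) / (x^2 - 4) \<and> w2 = -1 \<and> w3 = w1)
          \<or> (w1 = 1 \<and> w3 = 1 \<and> w2 + 1 / w2 = - 2 * (x^2 - 2) / x^2)
          \<or> (w1 + 1 / w1 = - 2 / x \<and> w2 = 1 / w1 \<and> w3 = 1)
          \<or> case_vi))
        \<and> (case_vi \<longrightarrow> w1 * w2 = - w3)"
proof -
  define x where "x = complex_of_nat q"
  define D where "D = (17 * real q - 1) * (real q - 1)"
  have D: "D \<ge> 0" "of_real D = (17 * x - 1) * (x - 1)"
    using hq by (simp_all add: D_def x_def)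
  have s: "(csqrt (of_real D))\<^sup>2 = (17 * x - 1) * (x - 1)"
    by (simp add: D(2))
  note nz = parameter_nondegenerate[OF hq, where 'a = complex, folded x_def]
  have "case_vi \<longleftrightarrow> (\<exists>r. r\<^sup>2 = D \<and> residual_branch x (of_real r) w1 w2 w3)"
    unfolding case_vi_def D_def x_def residual_branch_def
      alpha01_def alpha02_def alpha03_def alpha12_def Let_def ..
  also have "\<dots> \<longleftrightarrow> (\<exists>z. z\<^sup>2 = of_real D \<and> residual_branch x z w1 w2 w3)"
    by (rule ex_sqrt_of_real_iff[OF D(1), symmetric])
  finally have case_vi_iff: "case_vi \<longleftrightarrow>
      (\<exists>r. r\<^sup>2 = (17 * x - 1) * (x - 1) \<and> residual_branch x r w1 w2 w3)"
    unfolding D(2) .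
  have "case_vi \<longrightarrow> w1 * w2 = - w3"
    unfolding case_vi_iff using residual_branch_iff[OF hw(1) nz(1,3-5,8)] by auto
  moreover have "type_II (q\<^sup>2 - 1) W \<longleftrightarrow> type_II_equations x w1 w2 w3"
    unfolding W_def x_def by (rule type_II_iff_equations) (use hq hscheme hP hw in auto)
  ultimately show ?thesis
    using type_II_equations_solutions_iff[OF hw nz s] unfolding case_vi_iff Let_def x_def by blast
qed

end
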